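(* For any finite $k\ge2$: if there is an Ł$_{k_\vee}$ proof of a formula $D$ in $n$ steps, then there is an $\mathcal{H}\text{Łuk}_k$ proof of $D$ in $O(n^2\log n)$ steps.
   Context: Formulas are built from variables with $\wedge,\vee,\supset,\neg$. Ł$_k$ ($k$-valued Łukasiewicz logic): valuations into $\{0,\frac{1}{k-1},\ldots,1\}$ with $v(\neg A)=1-v(A)$, $v(A\wedge B)=\min$, $v(A\vee B)=\max$, $v(A\supset B)=\min(1,1-v(A)+v(B))$; validity = value $1$ under all valuations. $\mathcal{H}\text{Łuk}_k$ is a fixed sound and implicationally complete Frege system for Ł$_k$ (finitely many axiom schemas, sole rule modus ponens); steps = length of a proof. Ł$_{k_\vee}$: steps are sequents $\Gamma\Rightarrow A$ with $\Gamma$ a finite set of formulas; axioms: $\Rightarrow A$ for every instance $A$ of an $\mathcal{H}\text{Łuk}_k$ axiom schema, and $\{A\}\Rightarrow A$; rules: modus ponens (from $\Gamma_i\Rightarrow A$ and $\Gamma_j\Rightarrow A\supset B$ infer $\Gamma_i\cup\Gamma_j\Rightarrow B$) and $\vee_e$ (from $\Gamma_i\Rightarrow A\vee B$, $\Gamma_j\cup\{A\}\Rightarrow C$, $\Gamma_k\cup\{B\}\Rightarrow C$ infer $(\Gamma_i\cup\Gamma_j\cup\Gamma_k)\setminus\{A,B\}\Rightarrow C$). A proof of $D$ ends in $\Rightarrow D$; steps = number of sequents.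
   Formalization: The rule ∨_e is taken with conclusion Γ_i ∪ (Γ_j∖{A}) ∪ (Γ_k∖{B}) ⇒ C, since removing A and B from all three antecedents is unsound: from {p}⇒p∨p and {p}⇒p (twice) it yields ⇒p, which the sound Frege system does not prove. *)

theory Defs
  imports Complex_Main "HOL-Library.FSet" "HOL-Library.Landau_Symbols"
begin

datatype form =
    Var nat
  | Neg form
  | Conj form form
  | Disj form form
  | Imp form form

primrec subst :: "(nat \<Rightarrow> form) \<Rightarrow> form \<Rightarrow> form" where
  "subst \<sigma> (Var x) = \<sigma> x"
| "subst \<sigma> (Neg A) = Neg (subst \<sigma> A)"
| "subst \<sigma> (Conj A B) = Conj (subst \<sigma> A) (subst \<sigma> B)"
| "subst \<sigma> (Disj A B) = Disj (subst \<sigma> A) (subst \<sigma> B)"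
| "subst \<sigma> (Imp A B) = Imp (subst \<sigma> A) (subst \<sigma> B)"

primrec eval :: "(nat \<Rightarrow> real) \<Rightarrow> form \<Rightarrow> real" where
  "eval v (Var x) = v x"
| "eval v (Neg A) = 1 - eval v A"
| "eval v (Conj A B) = min (eval v A) (eval v B)"
| "eval v (Disj A B) = max (eval v A) (eval v B)"
| "eval v (Imp A B) = min 1 (1 - eval v A + eval v B)"

text \<open>Only meaningful for \<open>k \<ge> 2\<close>: at \<open>k = 1\<close> the division is by zero.\<close>

definition truth_values :: "nat \<Rightarrow> real set" where
  "truth_values k = {real i / (real k - 1) | i. i < k}"

definition luk_valuation :: "nat \<Rightarrow> (nat \<Rightarrow> real) \<Rightarrow> bool" where
  "luk_valuation k v \<longleftrightarrow> (\<forall>x. v x \<in> truth_values k)"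

definition luk_valid :: "nat \<Rightarrow> form \<Rightarrow> bool" where
  "luk_valid k A \<longleftrightarrow> (\<forall>v. luk_valuation k v \<longrightarrow> eval v A = 1)"

definition luk_entails :: "nat \<Rightarrow> form set \<Rightarrow> form \<Rightarrow> bool" where
  "luk_entails k \<Gamma> A \<longleftrightarrow>
    (\<forall>v. luk_valuation k v \<longrightarrow> (\<forall>B\<in>\<Gamma>. eval v B = 1) \<longrightarrow> eval v A = 1)"

text \<open>An axiom schema is represented by a formula whose variables play the role of
  metavariables, so a Frege system with modus ponens as its only rule is given by its set
  \<open>Ax\<close> of schemas.\<close>

definition instances :: "form set \<Rightarrow> form set" where
  "instances Ax = {subst \<sigma> A | \<sigma> A. A \<in> Ax}"

definition frege_derivation :: "form set \<Rightarrow> form set \<Rightarrow> form list \<Rightarrow> bool" where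
  "frege_derivation Ax \<Gamma> ps \<longleftrightarrow>
    (\<forall>i<length ps.
        ps ! i \<in> instances Ax
      \<or> ps ! i \<in> \<Gamma>
      \<or> (\<exists>j<i. \<exists>l<i. ps ! l = Imp (ps ! j) (ps ! i)))"

definition frege_derives :: "form set \<Rightarrow> form set \<Rightarrow> form \<Rightarrow> bool" where
  "frege_derives Ax \<Gamma> A \<longleftrightarrow> (\<exists>ps. frege_derivation Ax \<Gamma> ps \<and> ps \<noteq> [] \<and> last ps = A)"

definition frege_proof :: "form set \<Rightarrow> form list \<Rightarrow> form \<Rightarrow> bool" where
  "frege_proof Ax ps D \<longleftrightarrow> frege_derivation Ax {} ps \<and> ps \<noteq> [] \<and> last ps = D"

definition frege_sound :: "nat \<Rightarrow> form set \<Rightarrow> bool" where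
  "frege_sound k Ax \<longleftrightarrow> (\<forall>A. frege_derives Ax {} A \<longrightarrow> luk_valid k A)"

definition frege_implicationally_complete :: "nat \<Rightarrow> form set \<Rightarrow> bool" where
  "frege_implicationally_complete k Ax \<longleftrightarrow>
    (\<forall>\<Gamma> A. finite \<Gamma> \<longrightarrow> luk_entails k \<Gamma> A \<longrightarrow> frege_derives Ax \<Gamma> A)"

definition luk_frege_system :: "nat \<Rightarrow> form set \<Rightarrow> bool" where
  "luk_frege_system k Ax \<longleftrightarrow>
    finite Ax \<and> frege_sound k Ax \<and> frege_implicationally_complete k Ax"

type_synonym sequent = "form fset \<times> form"

text \<open>Disjunction elimination discharges \<open>A\<close> from the antecedent of the premise that
  assumes \<open>A\<close>, and \<open>B\<close> from that of the premise that assumes \<open>B\<close>, so its conclusion has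
  antecedent \<open>\<Gamma>\<^sub>i \<union> (\<Gamma>\<^sub>j - {A}) \<union> (\<Gamma>\<^sub>k - {B})\<close>.  This is \<open>(\<Gamma>\<^sub>i \<union> \<Gamma>\<^sub>j \<union> \<Gamma>\<^sub>k) - {A, B}\<close> as
  long as the discharged formulas are not also assumed elsewhere (\<open>A, B \<notin> \<Gamma>\<^sub>i\<close>, and
  \<open>B \<notin> \<Gamma>\<^sub>j\<close>, \<open>A \<notin> \<Gamma>\<^sub>k\<close> unless \<open>A = B\<close>).  Removing \<open>A\<close> and \<open>B\<close> from all three antecedents
  without that proviso is unsound: from \<open>{A} \<Rightarrow> A \<or> A\<close> and twice \<open>{A} \<Rightarrow> A\<close> it would yield
  \<open>\<Rightarrow> A\<close> for every \<open>A\<close>.\<close>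

inductive or_infer :: "form set \<Rightarrow> sequent set \<Rightarrow> sequent \<Rightarrow> bool"
  for Ax :: "form set" and P :: "sequent set" where
  schema: "A \<in> instances Ax \<Longrightarrow> or_infer Ax P ({||}, A)"
| identity: "or_infer Ax P ({|A|}, A)"
| modus_ponens:
    "(\<Gamma>\<^sub>i, A) \<in> P \<Longrightarrow> (\<Gamma>\<^sub>j, Imp A B) \<in> P \<Longrightarrow> or_infer Ax P (\<Gamma>\<^sub>i |\<union>| \<Gamma>\<^sub>j, B)"
| or_elim:
    "(\<Gamma>\<^sub>i, Disj A B) \<in> P \<Longrightarrow> (\<Gamma>\<^sub>j |\<union>| {|A|}, C) \<in> P \<Longrightarrow> (\<Gamma>\<^sub>k |\<union>| {|B|}, C) \<in> P \<Longrightarrow>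
     or_infer Ax P (\<Gamma>\<^sub>i |\<union>| (\<Gamma>\<^sub>j |-| {|A|}) |\<union>| (\<Gamma>\<^sub>k |-| {|B|}), C)"

definition or_proof :: "form set \<Rightarrow> sequent list \<Rightarrow> form \<Rightarrow> bool" where
  "or_proof Ax ss D \<longleftrightarrow>
    (\<forall>i<length ss. or_infer Ax (set (take i ss)) (ss ! i)) \<and> ss \<noteq> [] \<and> last ss = ({||}, D)"

end

theory Submission imports Defs begin

text \<open>In \<open>k\<close>-valued logic the iterated implication \<open>A \<supset> (A \<supset> \<dots> (A \<supset> B))\<close> with \<open>k - 1\<close>
  antecedents has the value of \<open>B\<close> if \<open>A\<close> has value \<open>1\<close>, and value \<open>1\<close> otherwise.  Writing
  \<open>A \<rightarrow> B\<close> for it, a sequent \<open>\<Gamma> \<Rightarrow> A\<close> is translated into \<open>\<And>\<Gamma> \<rightarrow> A\<close>, where \<open>\<And>\<Gamma>\<close> is the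
  right-nested conjunction of the members of \<open>\<Gamma>\<close> in the order in which they occur among the
  succedents \<open>H\<close> of the given proof.  By implicational completeness every fixed sound
  inference pattern costs a bounded number of Frege steps.  As all conjunctions are ordered
  by the same list \<open>H\<close>, a weakening \<open>A \<and> \<And>\<Gamma> \<rightarrow> \<And>\<Delta>\<close> with \<open>\<Delta> \<subseteq> \<Gamma> \<union> {A}\<close> is obtained by one
  pass through \<open>H\<close>, in \<open>O(n)\<close> steps; each sequent needs at most three weakenings.  The
  total is \<open>O(n\<^sup>2)\<close>, which is even slightly better than the bound claimed.\<close>

section \<open>Truth values\<close>

lemma truth_values_bounds:
  assumes "k \<ge> 2" "x \<in> truth_values k"
  shows "0 \<le> x" "x \<le> 1"
proof -
  obtain i where "x = real i / (real k - 1)" "i < k"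
    using assms(2) by (auto simp: truth_values_def)
  then show "0 \<le> x" "x \<le> 1"
    using assms(1) by (auto simp: divide_le_eq)
qed

text \<open>The largest truth value below 1 is 1 - 1/(k-1), so k-1 copies of the gap to 1 already
  add up to 1. This is where the number k-1 of antecedents comes from.\<close>

lemma truth_values_not_one:
  assumes "k \<ge> 2" "x \<in> truth_values k" "x \<noteq> 1"
  shows "real (k - 1) * (1 - x) \<ge> 1"
proof -
  obtain i where i: "x = real i / (real k - 1)" "i < k"
    using assms(2) by (auto simp: truth_values_def)
  have "i \<noteq> k - 1"
    using i assms by (auto simp: of_nat_diff)
  then have "real i + 2 \<le> real k"
    using i(2) by linarith
  then show ?thesis
    using i assms(1) by (simp add: of_nat_diff field_simps)
qed

lemma eval_truth_values:
  assumes "k \<ge> 2" "luk_valuation k v"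
  shows "eval v A \<in> truth_values k"
proof (induction A)
  case (Var x)
  then show ?case using assms(2) by (simp add: luk_valuation_def)
next
  case (Neg A)
  then obtain i where i: "eval v A = real i / (real k - 1)" "i < k"
    by (auto simp: truth_values_def)
  then have "eval v (Neg A) = real (k - 1 - i) / (real k - 1)"
    using assms(1) by (simp add: of_nat_diff field_simps)
  then show ?case
    using assms(1) by (force simp: truth_values_def)
next
  case (Conj A B)
  then show ?case by (simp add: min_def)
next
  case (Disj A B)
  then show ?case by (simp add: max_def)
next
  case (Imp A B)
  obtain i where i: "eval v A = real i / (real k - 1)" "i < k"
    using Imp by (auto simp: truth_values_def)
  obtain j where j: "eval v B = real j / (real k - 1)" "j < k"
    using Imp by (auto simp: truth_values_def)
  \<comment> \<open>Numerator over k-1. The natural subtraction does not truncate, since i < k; the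
    minimum with k-1 is the cap at value 1.\<close>
  have "eval v (Imp A B) = real (min (k - 1) (k - 1 + j - i)) / (real k - 1)"
  proof (cases "i \<le> j")
    case True
    then have "eval v A \<le> eval v B"
      using assms(1) i j by (simp add: divide_right_mono)
    moreover have "min (k - 1) (k - 1 + j - i) = k - 1"
      using True by simp
    ultimately show ?thesis
      using assms(1) by (simp add: of_nat_diff)
  next
    case False
    then have "eval v B \<le> eval v A"
      using assms(1) i j by (simp add: divide_right_mono)
    moreover have "real (min (k - 1) (k - 1 + j - i)) = real k - 1 + real j - real i"
      using False i(2) by linarith
    moreover have "(real k - 1 + real j - real i) / (real k - 1) = 1 - eval v A + eval v B"
      using assms(1) unfolding i(1) j(1) by (simp add: divide_simps)
    ultimately show ?thesis
      by simp
  qed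
  moreover have "min (k - 1) (k - 1 + j - i) < k"
    using assms(1) by auto
  ultimately show ?case
    unfolding truth_values_def by blast
qed

section \<open>Iterated implication and the value 1\<close>

primrec iter_imp :: "nat \<Rightarrow> form \<Rightarrow> form \<Rightarrow> form" where
  "iter_imp 0 A B = B"
| "iter_imp (Suc m) A B = Imp A (iter_imp m A B)"

lemma subst_iter_imp [simp]:
  "subst \<sigma> (iter_imp m A B) = iter_imp m (subst \<sigma> A) (subst \<sigma> B)"
  by (induction m) auto

text \<open>Each antecedent adds the nonnegative amount 1 - v(A), so capping at 1 after every step
  is the same as capping once at the end. The bound on B is what makes m = 0 fit.\<close>

lemma eval_iter_imp:
  assumes "eval v A \<le> 1" "eval v B \<le> 1"
  shows "eval v (iter_imp m A B) = min 1 (real m * (1 - eval v A) + eval v B)"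
  using assms by (induction m) (auto simp: algebra_simps min_def)

text \<open>If v(A) = 1, the sum is just v(B). Otherwise the k-1 gaps alone reach 1, and v(B) is
  nonnegative.\<close>

lemma eval_iter_imp_eq_1_iff:
  assumes "k \<ge> 2" "luk_valuation k v"
  shows "eval v (iter_imp (k - 1) A B) = 1 \<longleftrightarrow> (eval v A = 1 \<longrightarrow> eval v B = 1)"
proof -
  have "0 \<le> eval v C" "eval v C \<le> 1" for C
    using truth_values_bounds eval_truth_values assms by blast+
  then show ?thesis
    using truth_values_not_one[OF assms(1) eval_truth_values[OF assms, of A]]
      eval_iter_imp[of v A B "k - 1"]
    by (smt (verit, best) mult_cancel_right1 mult_zero_right)
qed

lemma eval_connectives_eq_1_iff:
  assumes "k \<ge> 2" "luk_valuation k v"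
  shows "eval v (Conj A B) = 1 \<longleftrightarrow> eval v A = 1 \<and> eval v B = 1"
    and "eval v (Disj A B) = 1 \<longleftrightarrow> eval v A = 1 \<or> eval v B = 1"
    and "eval v (Imp A B) = 1 \<longleftrightarrow> eval v A \<le> eval v B"
proof -
  have "eval v C \<le> 1" for C
    using truth_values_bounds eval_truth_values assms by blast
  from this[of A] this[of B] show
    "eval v (Conj A B) = 1 \<longleftrightarrow> eval v A = 1 \<and> eval v B = 1"
    "eval v (Disj A B) = 1 \<longleftrightarrow> eval v A = 1 \<or> eval v B = 1"
    "eval v (Imp A B) = 1 \<longleftrightarrow> eval v A \<le> eval v B"
    by auto
qed

section \<open>Bounded Frege derivations\<close>

lemma subst_subst: "subst \<sigma> (subst \<tau> A) = subst (subst \<sigma> \<circ> \<tau>) A"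
  by (induction A) auto

lemma subst_instances: "A \<in> instances Ax \<Longrightarrow> subst \<sigma> A \<in> instances Ax"
  unfolding instances_def using subst_subst by blast

text \<open>All of S is available in one common derivation of at most n lines. Lines used several
  times are thus counted once, and costs add up as S grows.\<close>

definition frege_within :: "form set \<Rightarrow> nat \<Rightarrow> form set \<Rightarrow> bool" where
  "frege_within Ax n S \<longleftrightarrow> (\<exists>ps. frege_derivation Ax {} ps \<and> length ps \<le> n \<and> S \<subseteq> set ps)"

lemma frege_within_mono:
  "frege_within Ax n S \<Longrightarrow> n \<le> n' \<Longrightarrow> S' \<subseteq> S \<Longrightarrow> frege_within Ax n' S'"
  unfolding frege_within_def by (meson order_trans)

text \<open>Justifications refer only to earlier lines, so the derivation can be cut off right after
  an occurrence of D.\<close>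

lemma frege_within_proof:
  assumes "frege_within Ax n S" "D \<in> S"
  shows "\<exists>ps. frege_proof Ax ps D \<and> length ps \<le> n"
proof -
  obtain ps where ps: "frege_derivation Ax {} ps" "length ps \<le> n" "D \<in> set ps"
    using assms unfolding frege_within_def by blast
  then obtain i where i: "i < length ps" "ps ! i = D"
    by (auto simp: in_set_conv_nth)
  have "frege_derivation Ax {} (take (Suc i) ps)"
    using ps(1) i(1) unfolding frege_derivation_def
    by (auto simp: less_Suc_eq) (smt (verit) less_SucI less_trans nth_take)+
  moreover have "last (take (Suc i) ps) = D"
    using i by (simp add: take_Suc_conv_app_nth)
  moreover have "take (Suc i) ps \<noteq> []"
    using i by auto
  ultimately show ?thesis
    using ps(2) unfolding frege_proof_def by (intro exI[of _ "take (Suc i) ps"]) auto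
qed

text \<open>Substitution maps axiom instances to axiom instances and commutes with
  \<open>Imp\<close>, so modus ponens survives it. The number of added lines does not depend on
  \<sigma>.\<close>

lemma frege_derivation_append_subst:
  assumes ps: "frege_derivation Ax {} ps"
    and qs: "frege_derivation Ax \<Gamma> qs"
    and \<Gamma>: "subst \<sigma> ` \<Gamma> \<subseteq> set ps"
  shows "frege_derivation Ax {} (ps @ map (subst \<sigma>) qs)"
  unfolding frege_derivation_def
proof (intro allI impI)
  let ?rs = "ps @ map (subst \<sigma>) qs"
  let ?ok = "\<lambda>i. ?rs ! i \<in> instances Ax \<or> ?rs ! i \<in> {} \<or>
      (\<exists>j<i. \<exists>l<i. ?rs ! l = Imp (?rs ! j) (?rs ! i))"
  have old: "?ok i" if "i < length ps" for i
  proof -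
    have "ps ! i \<in> instances Ax \<or> (\<exists>j<i. \<exists>l<i. ps ! l = Imp (ps ! j) (ps ! i))"
      using ps that unfolding frege_derivation_def by blast
    then show ?thesis
    proof
      assume "\<exists>j<i. \<exists>l<i. ps ! l = Imp (ps ! j) (ps ! i)"
      then obtain j l where "j < i" "l < i" "ps ! l = Imp (ps ! j) (ps ! i)"
        by blast
      then have "?rs ! l = Imp (?rs ! j) (?rs ! i)"
        using that by (simp add: nth_append)
      then show ?thesis
        using \<open>j < i\<close> \<open>l < i\<close> by blast
    qed (use that in \<open>simp add: nth_append\<close>)
  qed
  fix i assume i: "i < length ?rs"
  show "?ok i"
  proof (cases "i < length ps")
    case True
    then show ?thesis by (rule old)
  next
    case False
    define m where "m = i - length ps"
    have m: "m < length qs" "i = length ps + m"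
      using i False by (auto simp: m_def)
    have rs: "?rs ! (length ps + j) = subst \<sigma> (qs ! j)" if "j \<le> m" for j
      using m that by (simp add: nth_append)
    consider "qs ! m \<in> instances Ax" | "qs ! m \<in> \<Gamma>"
      | j l where "j < m" "l < m" "qs ! l = Imp (qs ! j) (qs ! m)"
      using qs m(1) unfolding frege_derivation_def by blast
    then show ?thesis
    proof cases
      case 1
      then show ?thesis
        using rs[of m] m(2) subst_instances by simp
    next
      case 2
      then obtain i' where i': "i' < length ps" "ps ! i' = subst \<sigma> (qs ! m)"
        using \<Gamma> by (metis image_eqI in_set_conv_nth subsetD)
      \<comment> \<open>A substituted hypothesis repeats line i' of \<open>ps\<close> and can reuse
        its justification, whose premises precede i' and hence i.\<close>
      then have eq: "?rs ! i = ?rs ! i'"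
        using rs[of m] m(2) by (simp add: nth_append)
      show ?thesis
        using old[OF i'(1)] i'(1) False unfolding eq
        by (meson less_trans not_less order_less_le_trans)
    next
      case 3
      then have "?rs ! (length ps + l) = Imp (?rs ! (length ps + j)) (?rs ! i)"
        using rs[of l] rs[of j] rs[of m] m(2) by simp
      then show ?thesis
        using 3 m(2) by (meson nat_add_left_cancel_less)
    qed
  qed
qed

section \<open>Sound inference patterns at constant cost\<close>

locale luk_frege =
  fixes k :: nat and Ax :: "form set"
  assumes k: "k \<ge> 2" and complete: "frege_implicationally_complete k Ax"
begin

text \<open>Completeness is applied once, to the schematic rule. The length of that one derivation
  is fixed before \<sigma> is chosen, so it bounds the cost of every instance, however large the
  substituted formulas are.\<close>

lemma bounded_rule:
  assumes "finite \<Gamma>" "luk_entails k \<Gamma> A"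
  shows "\<exists>c. \<forall>\<sigma> n S. frege_within Ax n S \<longrightarrow> subst \<sigma> ` \<Gamma> \<subseteq> S \<longrightarrow>
    frege_within Ax (n + c) (insert (subst \<sigma> A) S)"
proof -
  obtain qs where qs: "frege_derivation Ax \<Gamma> qs" "qs \<noteq> []" "last qs = A"
    using complete assms unfolding frege_implicationally_complete_def frege_derives_def by blast
  have "frege_within Ax (n + length qs) (insert (subst \<sigma> A) S)"
    if S: "frege_within Ax n S" "subst \<sigma> ` \<Gamma> \<subseteq> S" for \<sigma> n S
  proof -
    obtain ps where ps: "frege_derivation Ax {} ps" "length ps \<le> n" "S \<subseteq> set ps"
      using S(1) unfolding frege_within_def by blast
    have "subst \<sigma> A \<in> subst \<sigma> ` set qs"
      using qs by auto
    then show ?thesis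
      unfolding frege_within_def
      using frege_derivation_append_subst[OF ps(1) qs(1), of \<sigma>] S(2) ps
      by (intro exI[of _ "ps @ map (subst \<sigma>) qs"]) auto
  qed
  then show ?thesis by blast
qed

definition crisp_imp :: "form \<Rightarrow> form \<Rightarrow> form" (infixr "\<rightarrow>" 55) where
  "A \<rightarrow> B = iter_imp (k - 1) A B"

lemma subst_crisp_imp [simp]: "subst \<sigma> (A \<rightarrow> B) = subst \<sigma> A \<rightarrow> subst \<sigma> B"
  by (simp add: crisp_imp_def)

text \<open>As simp rules these turn an entailment between crisp implications into propositional
  reasoning about which formulas have value 1. Where other connectives occur,
  \<open>eval.simps\<close> is removed so that they do not unfold into arithmetic first.\<close>

lemmas eval_eq_1 =
  eval_iter_imp_eq_1_iff[OF k, folded crisp_imp_def] eval_connectives_eq_1_iff[OF k]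

text \<open>For the Lukasiewicz implication inside a sequent: its having value 1 is only a
  comparison of values.\<close>

lemma eval_mp:
  assumes "luk_valuation k v" "eval v A = 1" "eval v A \<le> eval v B"
  shows "eval v B = 1"
  using truth_values_bounds(2)[OF k eval_truth_values[OF k assms(1), of B]] assms by linarith

definition Top :: form where
  "Top = Imp (Var 0) (Var 0)"

primrec conjs :: "form list \<Rightarrow> form" where
  "conjs [] = Top"
| "conjs (A # As) = Conj A (conjs As)"

lemma bounded_rule_imp_top:
  "\<exists>c. \<forall>A n S. frege_within Ax n S \<longrightarrow> frege_within Ax (n + c) (insert (A \<rightarrow> Top) S)"
proof -
  \<comment> \<open>\<open>Top\<close> is written here with a metavariable of its own, because
    \<open>Var 0\<close> is about to be replaced by A; \<open>Top\<close> itself returns when that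
    metavariable is sent to \<open>Var 0\<close>.\<close>
  have "luk_entails k {} (Var 0 \<rightarrow> Imp (Var 1) (Var 1))"
    by (simp add: luk_entails_def eval_eq_1 del: eval.simps)
  from bounded_rule[OF _ this] obtain c where c: "\<And>\<sigma> n S. frege_within Ax n S \<Longrightarrow>
      frege_within Ax (n + c) (insert (subst \<sigma> (Var 0 \<rightarrow> Imp (Var 1) (Var 1))) S)"
    by auto
  show ?thesis
    apply (intro exI[of _ c] allI impI)
    subgoal for A n S
      \<comment> \<open>The substitution is list indexing: entry i instantiates metavariable
        i.\<close>
      using c[where \<sigma> = "(!) [A, Var 0]"] by (simp add: Top_def)
    done
qed

text \<open>The weakening step for a formula B that belongs to both conjunctions.\<close>

lemma bounded_rule_keep:
  "\<exists>c. \<forall>A X Y B n S. frege_within Ax n S \<longrightarrow> Conj A X \<rightarrow> Y \<in> S \<longrightarrow>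
    frege_within Ax (n + c) (insert (Conj A (Conj B X) \<rightarrow> Conj B Y) S)"
proof -
  have "luk_entails k {Conj (Var 0) (Var 1) \<rightarrow> Var 2}
      (Conj (Var 0) (Conj (Var 3) (Var 1)) \<rightarrow> Conj (Var 3) (Var 2))"
    by (simp add: luk_entails_def eval_eq_1 del: eval.simps)
  from bounded_rule[OF _ this] obtain c where c: "\<And>\<sigma> n S. frege_within Ax n S \<Longrightarrow>
      subst \<sigma> (Conj (Var 0) (Var 1) \<rightarrow> Var 2) \<in> S \<Longrightarrow>
      frege_within Ax (n + c)
        (insert (subst \<sigma> (Conj (Var 0) (Conj (Var 3) (Var 1)) \<rightarrow> Conj (Var 3) (Var 2))) S)"
    by auto
  show ?thesis
    apply (intro exI[of _ c] allI impI)
    subgoal for A X Y B n S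
      using c[where \<sigma> = "(!) [A, X, Y, B]"] by simp
    done
qed

text \<open>The weakening step for a formula wanted only on the right. It must be the extra formula
  A, which stays available as the head of the left side.\<close>

lemma bounded_rule_insert:
  "\<exists>c. \<forall>A X Y n S. frege_within Ax n S \<longrightarrow> Conj A X \<rightarrow> Y \<in> S \<longrightarrow>
    frege_within Ax (n + c) (insert (Conj A X \<rightarrow> Conj A Y) S)"
proof -
  have "luk_entails k {Conj (Var 0) (Var 1) \<rightarrow> Var 2}
      (Conj (Var 0) (Var 1) \<rightarrow> Conj (Var 0) (Var 2))"
    by (simp add: luk_entails_def eval_eq_1 del: eval.simps)
  from bounded_rule[OF _ this] obtain c where c: "\<And>\<sigma> n S. frege_within Ax n S \<Longrightarrow>
      subst \<sigma> (Conj (Var 0) (Var 1) \<rightarrow> Var 2) \<in> S \<Longrightarrow>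
      frege_within Ax (n + c)
        (insert (subst \<sigma> (Conj (Var 0) (Var 1) \<rightarrow> Conj (Var 0) (Var 2))) S)"
    by auto
  show ?thesis
    apply (intro exI[of _ c] allI impI)
    subgoal for A X Y n S
      using c[where \<sigma> = "(!) [A, X, Y]"] by simp
    done
qed

text \<open>The weakening step for a formula B present only on the left.\<close>

lemma bounded_rule_drop:
  "\<exists>c. \<forall>A X Y B n S. frege_within Ax n S \<longrightarrow> Conj A X \<rightarrow> Y \<in> S \<longrightarrow>
    frege_within Ax (n + c) (insert (Conj A (Conj B X) \<rightarrow> Y) S)"
proof -
  have "luk_entails k {Conj (Var 0) (Var 1) \<rightarrow> Var 2}
      (Conj (Var 0) (Conj (Var 3) (Var 1)) \<rightarrow> Var 2)"
    by (simp add: luk_entails_def eval_eq_1 del: eval.simps)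
  from bounded_rule[OF _ this] obtain c where c: "\<And>\<sigma> n S. frege_within Ax n S \<Longrightarrow>
      subst \<sigma> (Conj (Var 0) (Var 1) \<rightarrow> Var 2) \<in> S \<Longrightarrow>
      frege_within Ax (n + c)
        (insert (subst \<sigma> (Conj (Var 0) (Conj (Var 3) (Var 1)) \<rightarrow> Var 2)) S)"
    by auto
  show ?thesis
    apply (intro exI[of _ c] allI impI)
    subgoal for A X Y B n S
      using c[where \<sigma> = "(!) [A, X, Y, B]"] by simp
    done
qed

lemma bounded_rule_weaken:
  "\<exists>c. \<forall>A X n S. frege_within Ax n S \<longrightarrow> A \<in> S \<longrightarrow> frege_within Ax (n + c) (insert (X \<rightarrow> A) S)"
proof -
  have "luk_entails k {Var 0} (Var 1 \<rightarrow> Var 0)"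
    by (simp add: luk_entails_def eval_eq_1)
  from bounded_rule[OF _ this] obtain c where c: "\<And>\<sigma> n S. frege_within Ax n S \<Longrightarrow>
      subst \<sigma> (Var 0) \<in> S \<Longrightarrow> frege_within Ax (n + c) (insert (subst \<sigma> (Var 1 \<rightarrow> Var 0)) S)"
    by auto
  show ?thesis
    apply (intro exI[of _ c] allI impI)
    subgoal for A X n S
      using c[where \<sigma> = "(!) [A, X]"] by simp
    done
qed

text \<open>The instance itself is appended as a single line, whichever schema it comes from, and is
  then weakened by X.\<close>

lemma bounded_rule_schema:
  "\<exists>c. \<forall>A X n S. frege_within Ax n S \<longrightarrow> A \<in> instances Ax \<longrightarrow>
    frege_within Ax (n + c) (insert (X \<rightarrow> A) S)"
proof -
  obtain c where c: "\<And>A X n S. frege_within Ax n S \<Longrightarrow> A \<in> S \<Longrightarrow>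
      frege_within Ax (n + c) (insert (X \<rightarrow> A) S)"
    using bounded_rule_weaken by blast
  have "frege_within Ax (n + (1 + c)) (insert (X \<rightarrow> A) S)"
    if S: "frege_within Ax n S" and A: "A \<in> instances Ax" for A X n S
  proof -
    obtain ps where ps: "frege_derivation Ax {} ps" "length ps \<le> n" "S \<subseteq> set ps"
      using S unfolding frege_within_def by blast
    have "frege_derivation Ax {} [A]"
      using A by (simp add: frege_derivation_def)
    from frege_derivation_append_subst[OF ps(1) this, of Var]
    have "frege_within Ax (n + 1) (insert (subst Var A) S)"
      unfolding frege_within_def using ps by (intro exI[of _ "ps @ [subst Var A]"]) auto
    moreover have "subst Var A = A"
      by (induction A) auto
    ultimately have "frege_within Ax (n + 1) (insert A S)"
      by simp
    from c[OF this insertI1, of X] show ?thesis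
      by (rule frege_within_mono) auto
  qed
  then show ?thesis by blast
qed

lemma bounded_rule_head:
  "\<exists>c. \<forall>A X n S. frege_within Ax n S \<longrightarrow> frege_within Ax (n + c) (insert (Conj A X \<rightarrow> A) S)"
proof -
  have "luk_entails k {} (Conj (Var 0) (Var 1) \<rightarrow> Var 0)"
    by (simp add: luk_entails_def eval_eq_1 del: eval.simps)
  from bounded_rule[OF _ this] obtain c where c: "\<And>\<sigma> n S. frege_within Ax n S \<Longrightarrow>
      frege_within Ax (n + c) (insert (subst \<sigma> (Conj (Var 0) (Var 1) \<rightarrow> Var 0)) S)"
    by auto
  show ?thesis
    apply (intro exI[of _ c] allI impI)
    subgoal for A X n S
      using c[where \<sigma> = "(!) [A, X]"] by simp
    done
qed

text \<open>Turns the translation of the end sequent, whose antecedent is empty, into the formula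
  itself.\<close>

lemma bounded_rule_discharge_top:
  "\<exists>c. \<forall>A n S. frege_within Ax n S \<longrightarrow> Top \<rightarrow> A \<in> S \<longrightarrow> frege_within Ax (n + c) (insert A S)"
proof -
  have "luk_entails k {Imp (Var 1) (Var 1) \<rightarrow> Var 0} (Var 0)"
    by (simp add: luk_entails_def eval_eq_1 del: eval.simps)
  from bounded_rule[OF _ this] obtain c where c: "\<And>\<sigma> n S. frege_within Ax n S \<Longrightarrow>
      subst \<sigma> (Imp (Var 1) (Var 1) \<rightarrow> Var 0) \<in> S \<Longrightarrow>
      frege_within Ax (n + c) (insert (subst \<sigma> (Var 0)) S)"
    by auto
  show ?thesis
    apply (intro exI[of _ c] allI impI)
    subgoal for A n S
      using c[where \<sigma> = "(!) [A, Var 0]"] by (simp add: Top_def)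
    done
qed

text \<open>The first two formulas are weakenings of the joint antecedent G. \<open>Top\<close> is a
  dummy head, as \<open>linear_weakening\<close> always carries one extra formula.\<close>

lemma bounded_rule_modus_ponens:
  "\<exists>c. \<forall>G X Y A B n S. frege_within Ax n S \<longrightarrow>
    {Conj Top G \<rightarrow> X, Conj Top G \<rightarrow> Y, X \<rightarrow> A, Y \<rightarrow> Imp A B} \<subseteq> S \<longrightarrow>
    frege_within Ax (n + c) (insert (G \<rightarrow> B) S)"
proof -
  let ?T = "Imp (Var 5) (Var 5)"
  let ?\<Gamma> = "{Conj ?T (Var 0) \<rightarrow> Var 1, Conj ?T (Var 0) \<rightarrow> Var 2,
      Var 1 \<rightarrow> Var 3, Var 2 \<rightarrow> Imp (Var 3) (Var 4)}"
  have "luk_entails k ?\<Gamma> (Var 0 \<rightarrow> Var 4)"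
    by (auto simp: luk_entails_def eval_eq_1 simp del: eval.simps dest: eval_mp)
  from bounded_rule[OF _ this] obtain c where c: "\<And>\<sigma> n S. frege_within Ax n S \<Longrightarrow>
      subst \<sigma> ` ?\<Gamma> \<subseteq> S \<Longrightarrow> frege_within Ax (n + c) (insert (subst \<sigma> (Var 0 \<rightarrow> Var 4)) S)"
    by auto
  show ?thesis
    apply (intro exI[of _ c] allI impI)
    subgoal for G X Y A B n S
      using c[where \<sigma> = "(!) [G, X, Y, A, B, Var 0]"] by (simp add: Top_def)
    done
qed

text \<open>Case analysis is sound for crisp implication: a maximum equal to 1 forces one disjunct
  to be 1. In the two case premises the head supplies the discharged formula.\<close>

lemma bounded_rule_or_elim:
  "\<exists>c. \<forall>G X Y Z A B C n S. frege_within Ax n S \<longrightarrow>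
    {Conj Top G \<rightarrow> X, Conj A G \<rightarrow> Y, Conj B G \<rightarrow> Z, X \<rightarrow> Disj A B, Y \<rightarrow> C, Z \<rightarrow> C} \<subseteq> S \<longrightarrow>
    frege_within Ax (n + c) (insert (G \<rightarrow> C) S)"
proof -
  let ?\<Gamma> = "{Conj (Imp (Var 7) (Var 7)) (Var 0) \<rightarrow> Var 1, Conj (Var 4) (Var 0) \<rightarrow> Var 2,
      Conj (Var 5) (Var 0) \<rightarrow> Var 3, Var 1 \<rightarrow> Disj (Var 4) (Var 5),
      Var 2 \<rightarrow> Var 6, Var 3 \<rightarrow> Var 6}"
  have "luk_entails k ?\<Gamma> (Var 0 \<rightarrow> Var 6)"
    by (auto simp: luk_entails_def eval_eq_1 simp del: eval.simps)
  from bounded_rule[OF _ this] obtain c where c: "\<And>\<sigma> n S. frege_within Ax n S \<Longrightarrow>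
      subst \<sigma> ` ?\<Gamma> \<subseteq> S \<Longrightarrow> frege_within Ax (n + c) (insert (subst \<sigma> (Var 0 \<rightarrow> Var 6)) S)"
    by auto
  show ?thesis
    apply (intro exI[of _ c] allI impI)
    subgoal for G X Y Z A B C n S
      using c[where \<sigma> = "(!) [G, X, Y, Z, A, B, C, Var 0]"] by (simp add: Top_def)
    done
qed

section \<open>Simulating sequents\<close>

text \<open>Induction on H builds both conjunctions in parallel from the end of the list, with one
  bounded rule per entry. \<open>Suc\<close> pays for the empty list, where the target is
  \<open>Top\<close>.\<close>

lemma linear_weakening:
  "\<exists>c. \<forall>H A P Q n S. frege_within Ax n S \<longrightarrow> (\<forall>h\<in>set H. Q h \<longrightarrow> P h \<or> h = A) \<longrightarrow>
    frege_within Ax (n + c * Suc (length H))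
      (insert (Conj A (conjs (filter P H)) \<rightarrow> conjs (filter Q H)) S)"
proof -
  obtain c1 where top: "\<And>A n S. frege_within Ax n S \<Longrightarrow>
      frege_within Ax (n + c1) (insert (A \<rightarrow> Top) S)"
    using bounded_rule_imp_top by blast
  obtain c2 where keep: "\<And>A X Y B n S. frege_within Ax n S \<Longrightarrow> Conj A X \<rightarrow> Y \<in> S \<Longrightarrow>
      frege_within Ax (n + c2) (insert (Conj A (Conj B X) \<rightarrow> Conj B Y) S)"
    using bounded_rule_keep by blast
  obtain c3 where ins: "\<And>A X Y n S. frege_within Ax n S \<Longrightarrow> Conj A X \<rightarrow> Y \<in> S \<Longrightarrow>
      frege_within Ax (n + c3) (insert (Conj A X \<rightarrow> Conj A Y) S)"
    using bounded_rule_insert by blast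
  obtain c4 where drop: "\<And>A X Y B n S. frege_within Ax n S \<Longrightarrow> Conj A X \<rightarrow> Y \<in> S \<Longrightarrow>
      frege_within Ax (n + c4) (insert (Conj A (Conj B X) \<rightarrow> Y) S)"
    using bounded_rule_drop by blast
  define c where "c = c1 + c2 + c3 + c4"
  have "frege_within Ax (n + c * Suc (length H))
      (insert (Conj A (conjs (filter P H)) \<rightarrow> conjs (filter Q H)) S)"
    if S: "frege_within Ax n S" and H: "\<forall>h\<in>set H. Q h \<longrightarrow> P h \<or> h = A" for H A P Q n S
    using H
  proof (induction H)
    case Nil
    show ?case
      by (rule frege_within_mono[OF top[OF S]]) (auto simp: c_def)
  next
    case (Cons h H)
    let ?m = "n + c * Suc (length H)"
    let ?X = "conjs (filter P H)" and ?Y = "conjs (filter Q H)"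
    let ?F = "Conj A (conjs (filter P (h # H))) \<rightarrow> conjs (filter Q (h # H))"
    let ?S = "insert (Conj A ?X \<rightarrow> ?Y) S"
    have IH: "frege_within Ax ?m ?S"
      using Cons by auto
    have mem: "Conj A ?X \<rightarrow> ?Y \<in> ?S" by simp
    \<comment> \<open>The hypothesis on H excludes an entry wanted on the right that is neither on
      the left nor equal to A. In the last case the formula does not change, at cost 0.\<close>
    consider "P h" "Q h" | "P h" "\<not> Q h" | "\<not> P h" "Q h" "h = A" | "\<not> P h" "\<not> Q h"
      using Cons.prems by auto
    then have "\<exists>d\<le>c. frege_within Ax (?m + d) (insert ?F ?S)"
    proof cases
      case 1
      then show ?thesis
        using keep[OF IH mem, of h] by (intro exI[of _ c2]) (auto simp: c_def)
    next
      case 2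
      then show ?thesis
        using drop[OF IH mem, of h] by (intro exI[of _ c4]) (auto simp: c_def)
    next
      case 3
      then show ?thesis
        using ins[OF IH mem] by (intro exI[of _ c3]) (auto simp: c_def)
    next
      case 4
      then show ?thesis
        using IH by (intro exI[of _ 0]) auto
    qed
    then obtain d where d: "d \<le> c" "frege_within Ax (?m + d) (insert ?F ?S)"
      by blast
    show ?case
      by (rule frege_within_mono[OF d(2)]) (use d(1) in auto)
  qed
  then show ?thesis by blast
qed

text \<open>Antecedent members outside H are dropped. With H the succedents of a whole proof nothing
  is lost, since every assumption enters through an identity axiom. Repetitions in H are
  harmless.\<close>

definition translate :: "form list \<Rightarrow> sequent \<Rightarrow> form" where
  "translate H s = conjs (filter (\<lambda>h. h |\<in>| fst s) H) \<rightarrow> snd s"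

lemma or_infer_translate:
  "\<exists>c. \<forall>H P s n. frege_within Ax n (translate H ` P) \<longrightarrow> or_infer Ax P s \<longrightarrow> snd s \<in> set H \<longrightarrow>
    frege_within Ax (n + c * Suc (length H)) (translate H ` insert s P)"
proof -
  obtain c0 where weak: "\<And>H A P Q n S. frege_within Ax n S \<Longrightarrow>
      \<forall>h\<in>set H. Q h \<longrightarrow> P h \<or> h = A \<Longrightarrow>
      frege_within Ax (n + c0 * Suc (length H))
        (insert (Conj A (conjs (filter P H)) \<rightarrow> conjs (filter Q H)) S)"
    using linear_weakening by blast
  obtain c1 where sch: "\<And>A X n S. frege_within Ax n S \<Longrightarrow> A \<in> instances Ax \<Longrightarrow>
      frege_within Ax (n + c1) (insert (X \<rightarrow> A) S)"
    using bounded_rule_schema by blast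
  obtain c2 where head: "\<And>A X n S. frege_within Ax n S \<Longrightarrow>
      frege_within Ax (n + c2) (insert (Conj A X \<rightarrow> A) S)"
    using bounded_rule_head by blast
  obtain c3 where mp: "\<And>G X Y A B n S. frege_within Ax n S \<Longrightarrow>
      {Conj Top G \<rightarrow> X, Conj Top G \<rightarrow> Y, X \<rightarrow> A, Y \<rightarrow> Imp A B} \<subseteq> S \<Longrightarrow>
      frege_within Ax (n + c3) (insert (G \<rightarrow> B) S)"
    using bounded_rule_modus_ponens by blast
  obtain c4 where orE: "\<And>G X Y Z A B C n S. frege_within Ax n S \<Longrightarrow>
      {Conj Top G \<rightarrow> X, Conj A G \<rightarrow> Y, Conj B G \<rightarrow> Z, X \<rightarrow> Disj A B, Y \<rightarrow> C, Z \<rightarrow> C} \<subseteq> S \<Longrightarrow>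
      frege_within Ax (n + c4) (insert (G \<rightarrow> C) S)"
    using bounded_rule_or_elim by blast
  define c where "c = 3 * c0 + c1 + c2 + c3 + c4"
  have "frege_within Ax (n + c * Suc (length H)) (translate H ` insert s P)"
    if S: "frege_within Ax n (translate H ` P)" and inf: "or_infer Ax P s" and s: "snd s \<in> set H"
    for H P s n
  proof -
    let ?S = "translate H ` P"
    let ?w = "c0 * Suc (length H)"
    let ?J = "\<lambda>\<Gamma>. conjs (filter (\<lambda>h. h |\<in>| \<Gamma>) H)"
    \<comment> \<open>A budget common to all four cases: three weakenings plus rules of constant
      cost d, with d absorbed into a multiple of \<open>Suc (length H)\<close>.\<close>
    have final: ?thesis if "frege_within Ax (n + 3 * ?w + d) S'" "d \<le> c1 + c2 + c3 + c4"
      "insert (translate H s) ?S \<subseteq> S'" for d S'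
    proof (rule frege_within_mono[OF that(1)])
      have "d \<le> (c1 + c2 + c3 + c4) * Suc (length H)"
        using that(2) by (simp add: trans_le_add1)
      then show "n + 3 * ?w + d \<le> n + c * Suc (length H)"
        unfolding c_def add_mult_distrib mult.assoc by linarith
    qed (use that(3) in simp)
    from inf show ?thesis
    proof cases
      case (schema A)
      have "frege_within Ax (n + 3 * ?w + c1) (insert (?J {||} \<rightarrow> A) ?S)"
        by (rule sch[OF frege_within_mono[OF S]]) (use schema in auto)
      then show ?thesis
        by (rule final) (simp_all add: schema(1) translate_def)
    next
      case (identity A)
      \<comment> \<open>A occurs in H because it is the succedent. H may contain several copies: the
        first is split off as head and the rest form \<open>Bs\<close>.\<close>
      have "filter (\<lambda>h. h |\<in>| {|A|}) H \<noteq> []"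
        using s identity by (auto simp: filter_empty_conv)
      then obtain B Bs where Bs: "filter (\<lambda>h. h |\<in>| {|A|}) H = B # Bs"
        by (meson neq_Nil_conv)
      then have "B \<in> set (filter (\<lambda>h. h |\<in>| {|A|}) H)"
        by (metis list.set_intros(1))
      then have B: "B = A"
        by simp
      have "frege_within Ax (n + 3 * ?w + c2) (insert (Conj A (conjs Bs) \<rightarrow> A) ?S)"
        by (rule head[OF frege_within_mono[OF S]]) auto
      then show ?thesis
        by (rule final) (use Bs B in \<open>simp_all add: identity(1) translate_def\<close>)
    next
      case (modus_ponens \<Gamma>\<^sub>i A \<Gamma>\<^sub>j B)
      let ?G = "?J (\<Gamma>\<^sub>i |\<union>| \<Gamma>\<^sub>j)"
      let ?S' = "insert (Conj Top ?G \<rightarrow> ?J \<Gamma>\<^sub>j) (insert (Conj Top ?G \<rightarrow> ?J \<Gamma>\<^sub>i) ?S)"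
      have "frege_within Ax (n + ?w + ?w) ?S'"
        by (intro weak S) auto
      then have "frege_within Ax (n + 3 * ?w) ?S'"
        by (rule frege_within_mono) auto
      moreover have "?J \<Gamma>\<^sub>i \<rightarrow> A \<in> ?S" "?J \<Gamma>\<^sub>j \<rightarrow> Imp A B \<in> ?S"
        using modus_ponens by (force simp: translate_def)+
      ultimately have "frege_within Ax (n + 3 * ?w + c3) (insert (?G \<rightarrow> B) ?S')"
        by (intro mp[of _ _ _ "?J \<Gamma>\<^sub>i" "?J \<Gamma>\<^sub>j" A]) auto
      then show ?thesis
        by (rule final) (auto simp: modus_ponens(1) translate_def)
    next
      case (or_elim \<Gamma>\<^sub>i A B \<Gamma>\<^sub>j C \<Gamma>\<^sub>k)
      let ?G = "?J (\<Gamma>\<^sub>i |\<union>| (\<Gamma>\<^sub>j |-| {|A|}) |\<union>| (\<Gamma>\<^sub>k |-| {|B|}))"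
      let ?X = "?J \<Gamma>\<^sub>i" and ?Y = "?J (\<Gamma>\<^sub>j |\<union>| {|A|})" and ?Z = "?J (\<Gamma>\<^sub>k |\<union>| {|B|})"
      let ?S' = "insert (Conj B ?G \<rightarrow> ?Z) (insert (Conj A ?G \<rightarrow> ?Y)
          (insert (Conj Top ?G \<rightarrow> ?X) ?S))"
      \<comment> \<open>The heads A and B put back what \<open>|-|\<close> removed from
        \<open>\<Gamma>\<^sub>j\<close> and \<open>\<Gamma>\<^sub>k\<close>; for
        \<open>\<Gamma>\<^sub>i\<close> the dummy \<open>Top\<close> is enough.\<close>
      have "frege_within Ax (n + ?w + ?w + ?w) ?S'"
        by (intro weak S) auto
      then have "frege_within Ax (n + 3 * ?w) ?S'"
        by (rule frege_within_mono) auto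
      moreover have "?X \<rightarrow> Disj A B \<in> ?S" "?Y \<rightarrow> C \<in> ?S" "?Z \<rightarrow> C \<in> ?S"
        using or_elim(2-4)[THEN imageI[of _ _ "translate H"]]
        by (simp_all only: translate_def fst_conv snd_conv)
      ultimately have "frege_within Ax (n + 3 * ?w + c4) (insert (?G \<rightarrow> C) ?S')"
        by (intro orE[of _ _ _ ?X A ?Y B ?Z]) auto
      then show ?thesis
        by (rule final) (auto simp: or_elim(1) translate_def)
    qed
  qed
  then show ?thesis by blast
qed

lemma or_proof_quadratic:
  "\<exists>c. \<forall>ss D. or_proof Ax ss D \<longrightarrow>
    (\<exists>ps. frege_proof Ax ps D \<and> length ps \<le> length ss * (c * Suc (length ss)) + c)"
proof -
  obtain c1 where c1: "\<And>H P s n. frege_within Ax n (translate H ` P) \<Longrightarrow> or_infer Ax P s \<Longrightarrow>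
      snd s \<in> set H \<Longrightarrow>
      frege_within Ax (n + c1 * Suc (length H)) (translate H ` insert s P)"
    using or_infer_translate by blast
  obtain c2 where c2: "\<And>A n S. frege_within Ax n S \<Longrightarrow> Top \<rightarrow> A \<in> S \<Longrightarrow>
      frege_within Ax (n + c2) (insert A S)"
    using bounded_rule_discharge_top by blast
  have "\<exists>ps. frege_proof Ax ps D \<and>
      length ps \<le> length ss * ((c1 + c2) * Suc (length ss)) + (c1 + c2)"
    if ss: "or_proof Ax ss D" for ss D
  proof -
    \<comment> \<open>One list for the whole proof, of length n: every inference then costs O(n),
      and the n inferences together O(n^2).\<close>
    define H where "H = map snd ss"
    have "frege_within Ax (i * (c1 * Suc (length H))) (translate H ` set (take i ss))"
      if "i \<le> length ss" for i
      using that
    proof (induction i)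
      case 0
      show ?case
        by (auto simp: frege_within_def frege_derivation_def)
    next
      case (Suc i)
      then have "or_infer Ax (set (take i ss)) (ss ! i)"
        using ss by (simp add: or_proof_def)
      moreover have "snd (ss ! i) \<in> set H"
        using Suc.prems by (simp add: H_def)
      moreover have "set (take (Suc i) ss) = insert (ss ! i) (set (take i ss))"
        using Suc.prems by (simp add: take_Suc_conv_app_nth)
      ultimately show ?case
        using c1[OF Suc.IH] Suc.prems by (simp add: add.commute)
    qed
    from this[of "length ss"]
    have "frege_within Ax (length ss * (c1 * Suc (length ss))) (translate H ` set ss)"
      by (simp add: H_def)
    moreover have "Top \<rightarrow> D \<in> translate H ` set ss"
    proof -
      have "({||}, D) \<in> set ss"
        using ss unfolding or_proof_def by (metis last_in_set)
      then show ?thesis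
        by (force simp: translate_def)
    qed
    ultimately have "frege_within Ax (length ss * (c1 * Suc (length ss)) + c2)
        (insert D (translate H ` set ss))"
      by (rule c2)
    then obtain ps where "frege_proof Ax ps D"
      and len: "length ps \<le> length ss * (c1 * Suc (length ss)) + c2"
      using frege_within_proof by blast
    moreover have "length ss * (c1 * Suc (length ss)) \<le> length ss * ((c1 + c2) * Suc (length ss))"
      by (intro mult_le_mono) auto
    ultimately show ?thesis
      by (intro exI[of _ ps]) linarith
  qed
  then show ?thesis by blast
qed

end

section \<open>Asymptotics and conclusion\<close>

lemma quadratic_bigo_square_ln:
  fixes c :: real
  assumes "c \<ge> 0"
  shows "(\<lambda>n. real n * (c * (real n + 1)) + c) \<in> O(\<lambda>n. real n ^ 2 * ln (real n))"
\<comment> \<open>For n \<ge> 3 > e the logarithm is at least 1, and n^2 + n + 1 \<le> 3 n^2; hence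
  the factor 3.\<close>
proof (rule bigoI[of _ "3 * c"])
  show "\<forall>\<^sub>F n in sequentially. norm (real n * (c * (real n + 1)) + c)
      \<le> 3 * c * norm (real n ^ 2 * ln (real n))"
    using eventually_ge_at_top[of 3]
  proof eventually_elim
    case (elim n)
    have "exp 1 \<le> real n"
      using exp_le elim by linarith
    then have ln: "1 \<le> ln (real n)"
      using elim by (simp add: ln_ge_iff)
    have "real n \<le> real n ^ 2" "1 \<le> real n ^ 2"
      using elim by (auto intro: self_le_power one_le_power)
    then have "real n ^ 2 + real n + 1 \<le> 3 * real n ^ 2"
      by linarith
    also have "\<dots> \<le> 3 * (real n ^ 2 * ln (real n))"
      using mult_left_mono[OF ln, of "real n ^ 2"] by simp
    finally have "c * (real n ^ 2 + real n + 1) \<le> c * (3 * (real n ^ 2 * ln (real n)))"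
      using assms by (rule mult_left_mono)
    moreover have "real n * (c * (real n + 1)) + c = c * (real n ^ 2 + real n + 1)"
      by (simp add: power2_eq_square algebra_simps)
    moreover have "c * (real n ^ 2 + real n + 1) \<ge> 0" "real n ^ 2 * ln (real n) \<ge> 0"
      using assms ln by auto
    ultimately show ?case
      by (simp only: real_norm_def abs_of_nonneg mult.assoc mult.left_commute[of c])
  qed
qed

theorem theorem13:
  fixes k :: nat and Ax :: "form set"
  assumes "k \<ge> 2"
    and "luk_frege_system k Ax"
  shows "\<exists>f :: nat \<Rightarrow> real. f \<in> O(\<lambda>n. real n ^ 2 * ln (real n)) \<and>
    (\<forall>D n. (\<exists>ss. or_proof Ax ss D \<and> length ss = n) \<longrightarrow>
      (\<exists>ps. frege_proof Ax ps D \<and> real (length ps) \<le> f n))"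
proof -
  interpret luk_frege k Ax
    using assms by unfold_locales (auto simp: luk_frege_system_def)
  obtain c where c: "\<And>ss D. or_proof Ax ss D \<Longrightarrow>
      \<exists>ps. frege_proof Ax ps D \<and> length ps \<le> length ss * (c * Suc (length ss)) + c"
    using or_proof_quadratic by blast
  \<comment> \<open>The natural-number bound read over the reals, with \<open>Suc n\<close> as n +
    1. The constant c depends only on k and \<open>Ax\<close>, so one f serves all D.\<close>
  define f :: "nat \<Rightarrow> real" where "f = (\<lambda>n. real n * (real c * (real n + 1)) + real c)"
  have "\<exists>ps. frege_proof Ax ps D \<and> real (length ps) \<le> f (length ss)" if "or_proof Ax ss D" for ss D
  proof -
    obtain ps where "frege_proof Ax ps D"
      and "length ps \<le> length ss * (c * Suc (length ss)) + c"
      using c \<open>or_proof Ax ss D\<close> by blast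
    moreover from this(2) have "real (length ps) \<le> real (length ss * (c * Suc (length ss)) + c)"
      by (rule of_nat_mono)
    ultimately show ?thesis
      by (intro exI[of _ ps]) (simp add: f_def algebra_simps)
  qed
  moreover have "f \<in> O(\<lambda>n. real n ^ 2 * ln (real n))"
    unfolding f_def by (rule quadratic_bigo_square_ln) simp
  ultimately show ?thesis
    by blast
qed

end
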